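(* Let $k<n$ be natural numbers (with $k\ge 1$) and let $T_{n,k}=K_k\vee\overline{K_{n-k}}$. The multiset of eigenvalues of the adjacency matrix of $T_{n,k}$ consists of $\lambda_1$ and $\lambda_2$ (each once), $-1$ with multiplicity $k-1$, and $0$ with multiplicity $n-k-1$, where $$\lambda_{1},\lambda_2 = \frac{(k-1)\pm\sqrt{(k-1)^2+4k(n-k)}}{2}.$$
   Context: $K_m$ is the complete graph on $m$ vertices, $\overline{K_m}$ the empty graph on $m$ vertices, and $G\vee H$ denotes the join (disjoint union together with all edges between $V(G)$ and $V(H)$). *)

theory Defs
  imports "Graph_Theory.Graph_Theory" "Jordan_Normal_Form.Char_Poly"
    "HOL-Computational_Algebra.Polynomial" Complex_Main
begin

text \<open>
  As in \<^theory>\<open>Graph_Theory.Pair_Digraph\<close>, a finite simple graph is a \<^const>\<open>pair_graph\<close>: an edge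
  between \<open>u\<close> and \<open>v\<close> is represented by the two arcs \<open>(u, v)\<close> and \<open>(v, u)\<close>. The complete graph
  on \<open>m\<close> vertices is the library's \<^const>\<open>complete_digraph\<close>, a predicate on graphs; the empty graph
  is treated in the same way.
\<close>

definition empty_digraph :: "nat \<Rightarrow> ('a, 'b) pre_digraph \<Rightarrow> bool" where
  "empty_digraph m G \<longleftrightarrow> graph G \<and> card (verts G) = m \<and> arcs_ends G = {}"

definition graph_join ::
  "'a pair_pre_digraph \<Rightarrow> 'b pair_pre_digraph \<Rightarrow> ('a + 'b) pair_pre_digraph" where
  "graph_join G H =
     \<lparr> pverts = pverts G <+> pverts H,
       parcs = map_prod Inl Inl ` parcs G \<union> map_prod Inr Inr ` parcs H
             \<union> Inl ` pverts G \<times> Inr ` pverts H \<union> Inr ` pverts H \<times> Inl ` pverts G \<rparr>"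

lemma pair_graph_graph_join:
  assumes "pair_graph G" and "pair_graph H"
  shows "pair_graph (graph_join G H)"
proof -
  interpret G: pair_graph G by fact
  interpret H: pair_graph H by fact
  have "sym (parcs G)" "sym (parcs H)"
    using G.pair_sym_arcs H.pair_sym_arcs by (simp_all add: symmetric_def)
  hence "sym (parcs (graph_join G H))"
    unfolding graph_join_def sym_def by auto
  thus ?thesis
    by unfold_locales
      (auto simp: graph_join_def symmetric_def G.pair_finite_verts H.pair_finite_verts
        G.pair_finite_arcs H.pair_finite_arcs
        dest: G.wellformed' H.wellformed' G.no_loops' H.no_loops')
qed

text \<open>
  The adjacency matrix depends on an enumeration \<open>vs\<close> of the vertices, i.e. a list containing
  each vertex exactly once.
\<close>

definition adjacency_matrix :: "'a pair_pre_digraph \<Rightarrow> 'a list \<Rightarrow> 'c :: zero_neq_one mat" where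
  "adjacency_matrix G vs =
     mat (length vs) (length vs) (\<lambda>(i, j). if (vs ! i, vs ! j) \<in> parcs G then 1 else 0)"

text \<open>
  Eigenvalues are counted with algebraic multiplicity. They are taken in the complex numbers, so
  that no eigenvalue can be lost.
\<close>

definition eigenvalue_mset :: "complex mat \<Rightarrow> complex multiset" where
  "eigenvalue_mset A = proots (char_poly A)"

end

theory Submission
  imports Defs
begin

text \<open>
  Let \<open>s\<close> be the indicator vector of the clique and \<open>u\<close> that of its complement. The adjacency
  matrix is \<open>s 1\<^sup>T + u s\<^sup>T - diag s\<close>, so \<open>x I - A\<close> is a rank two perturbation of the invertible
  diagonal matrix \<open>diag (x + s)\<close> for every \<open>x\<close> except \<open>0\<close> and \<open>-1\<close>, and the matrix determinant
  lemma reduces its determinant to a \<open>2 \<times> 2\<close> one. Two polynomials that agree at infinitely many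
  points are equal.
\<close>

text \<open>Right multiplication by the block lower triangular matrix with ones on the diagonal and
  \<open>- C\<close> below it clears \<open>C\<close>, and that matrix has determinant
  \<open>1\<close>.\<close>

lemma det_four_block_mat_one_lower_right:
  fixes A :: "'a :: idom mat"
  assumes A: "A \<in> carrier_mat n n" and B: "B \<in> carrier_mat n m" and C: "C \<in> carrier_mat m n"
  shows "det (four_block_mat A B C (1\<^sub>m m)) = det (A - B * C)"
proof -
  let ?L = "four_block_mat (1\<^sub>m n) (0\<^sub>m n m) (- C) (1\<^sub>m m)"
  have "four_block_mat A B C (1\<^sub>m m) * ?L = four_block_mat (A - B * C) B (0\<^sub>m m n) (1\<^sub>m m)"
    using A B C by (subst mult_four_block_mat[OF A B C one_carrier_mat]) auto
  moreover have "det ?L = 1"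
    using C by (subst det_four_block_mat_upper_right_zero) auto
  moreover have "det (four_block_mat A B C (1\<^sub>m m) * ?L) = det (four_block_mat A B C (1\<^sub>m m)) * det ?L"
    using A B C by (intro det_mult[of _ "n + m"]) auto
  moreover have "det (four_block_mat (A - B * C) B (0\<^sub>m m n) (1\<^sub>m m)) = det (A - B * C)"
    using A B C by (subst det_four_block_mat_lower_left_zero) auto
  ultimately show ?thesis by simp
qed

text \<open>The mirror image: left multiplication by a unipotent matrix with block
  \<open>- (C * A')\<close> clears \<open>C\<close>. The inverse of \<open>A\<close> is passed
  explicitly as \<open>A'\<close>, since entries lie only in an integral domain.\<close>

lemma det_four_block_mat_Schur_complement:
  fixes A :: "'a :: idom mat"
  assumes A: "A \<in> carrier_mat n n" and A': "A' \<in> carrier_mat n n" and inv: "A' * A = 1\<^sub>m n"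
    and B: "B \<in> carrier_mat n m" and C: "C \<in> carrier_mat m n" and E: "E \<in> carrier_mat m m"
  shows "det (four_block_mat A B C E) = det A * det (E - C * A' * B)"
proof -
  let ?L = "four_block_mat (1\<^sub>m n) (0\<^sub>m n m) (- (C * A')) (1\<^sub>m m)"
  have "C * A' * A = C"
    using A A' C inv by simp
  hence "?L * four_block_mat A B C E = four_block_mat A B (0\<^sub>m m n) (E - C * A' * B)"
    using A A' B C E by (subst mult_four_block_mat[OF one_carrier_mat _ _ _ A B C E]) auto
  moreover have "det ?L = 1"
    using A' C by (subst det_four_block_mat_upper_right_zero) auto
  moreover have "det (?L * four_block_mat A B C E) = det ?L * det (four_block_mat A B C E)"
    using A A' B C E by (intro det_mult[of _ "n + m"]) auto
  moreover have "det (four_block_mat A B (0\<^sub>m m n) (E - C * A' * B)) = det A * det (E - C * A' * B)"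
    using A A' B C E by (subst det_four_block_mat_lower_left_zero) auto
  ultimately show ?thesis by simp
qed

text \<open>The matrix determinant lemma: both sides evaluate the determinant of the block matrix
  \<open>A, B, C, 1\<close>, once by clearing \<open>C\<close> from the right and once from the
  left.\<close>

lemma det_minus_mult_mat:
  fixes A :: "'a :: idom mat"
  assumes "A \<in> carrier_mat n n" and "A' \<in> carrier_mat n n" and "A' * A = 1\<^sub>m n"
    and "B \<in> carrier_mat n m" and "C \<in> carrier_mat m n"
  shows "det (A - B * C) = det A * det (1\<^sub>m m - C * A' * B)"
  using assms by (simp add: det_four_block_mat_Schur_complement
    flip: det_four_block_mat_one_lower_right)

lemma det_mat_2:
  fixes A :: "'a :: idom mat"
  assumes "A \<in> carrier_mat 2 2"
  shows "det A = A $$ (0, 0) * A $$ (1, 1) - A $$ (0, 1) * A $$ (1, 0)"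
  using assms
  by (subst laplace_expansion_row[of _ 2 0])
    (auto simp: numeral_2_eq_2 lessThan_Suc cofactor_def det_single mat_delete_def)

lemma poly_char_poly_split_graph:
  fixes x :: "'a :: field"
  assumes S: "S \<subseteq> {..<n}" "card S = k" and k: "1 \<le> k" "k < n" and x: "x \<noteq> 0" "x + 1 \<noteq> 0"
  shows "poly (char_poly (mat n n (\<lambda>(i, j). if i \<noteq> j \<and> (i \<in> S \<or> j \<in> S) then 1 else 0))) x =
    (x + 1) ^ (k - 1) * x ^ (n - k - 1) * (x\<^sup>2 - of_nat (k - 1) * x - of_nat k * of_nat (n - k))"
proof -
  let ?A = "mat n n (\<lambda>(i, j). if i \<noteq> j \<and> (i \<in> S \<or> j \<in> S) then 1 else 0) :: 'a mat"
  \<comment> \<open>The product \<open>U * V\<close> below has a \<open>1\<close> at each diagonal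
    position in \<open>S\<close>, where the adjacency matrix has \<open>0\<close>; the summand
    \<open>1\<close> in \<open>d\<close> compensates for it.\<close>
  define d where "d i = (if i \<in> S then x + 1 else x)" for i
  define D where "D = mat n n (\<lambda>(i, j). if i = j then d i else 0)"
  define D' where "D' = mat n n (\<lambda>(i, j). if i = j then inverse (d i) else 0)"
  \<comment> \<open>The columns of \<open>U\<close> are the indicators of \<open>S\<close> and of
    its complement; the rows of \<open>V\<close> are the all-ones vector and the indicator of
    \<open>S\<close>.\<close>
  define U :: "'a mat" where "U = mat n 2 (\<lambda>(i, j). of_bool (i \<in> S \<longleftrightarrow> j = 0))"
  define V :: "'a mat" where "V = mat 2 n (\<lambda>(i, j). of_bool (i = 0 \<or> j \<in> S))"
  define p where "p = of_nat k / (x + 1)"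
  define t where "t = of_nat (n - k) / x"
  note carrier = D_def D'_def U_def V_def
  have d: "d i \<noteq> 0" for i using x by (simp add: d_def)
  have fin: "finite S" using S finite_subset by blast
  have card_compl: "card ({..<n} - S) = n - k"
    using S fin by (simp add: card_Diff_subset)
  have split: "(\<Sum>i<n. f i) = sum f S + sum f ({..<n} - S)"
    "(\<Prod>i<n. g i) = prod g S * prod g ({..<n} - S)" for f g :: "nat \<Rightarrow> 'a"
    using sum.subset_diff[OF S(1), of f] prod.subset_diff[OF S(1), of g]
    by (simp_all add: ac_simps)
  have inv: "D' * D = 1\<^sub>m n"
    using d by (intro eq_matI)
      (auto simp: carrier scalar_prod_def if_distrib cong: if_cong intro!: sum.neutral)
  \<comment> \<open>Each entry sums \<open>inverse (d l)\<close> over \<open>S\<close> (giving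
    \<open>p\<close>) or over the complement (giving \<open>t\<close>); the lower right entry
    vanishes because the supports are disjoint.\<close>
  have prodeq: "V * D' * U = mat 2 2 (\<lambda>(i, j). if j = 0 then p else if i = 0 then t else 0)"
  proof (rule eq_matI)
    fix i j assume "i < dim_row (mat 2 2 (\<lambda>(i, j). if j = 0 then p else if i = 0 then t else 0))"
      and "j < dim_col (mat 2 2 (\<lambda>(i, j). if j = 0 then p else if i = 0 then t else 0))"
    hence ij: "i < 2" "j < 2" by auto
    have VD: "(V * D') $$ (i, l) = of_bool (i = 0 \<or> l \<in> S) * inverse (d l)" if "l < n" for l
      using that ij by (simp add: carrier scalar_prod_def if_distrib cong: if_cong)
    have "(V * D' * U) $$ (i, j) = (\<Sum>l<n. (V * D') $$ (i, l) * U $$ (l, j))"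
      using ij by (simp add: carrier scalar_prod_def lessThan_atLeast0)
    also have "\<dots> = (\<Sum>l<n. of_bool (i = 0 \<or> l \<in> S) * inverse (d l) * of_bool (l \<in> S \<longleftrightarrow> j = 0))"
      using ij by (intro sum.cong refl arg_cong2[of _ _ _ _ "(*)"] VD) (auto simp: U_def)
    also have "\<dots> = (if j = 0 then p else if i = 0 then t else 0)"
      unfolding split by (auto simp: d_def p_def t_def card_compl S divide_inverse)
    finally show "(V * D' * U) $$ (i, j) =
        mat 2 2 (\<lambda>(i, j). if j = 0 then p else if i = 0 then t else 0) $$ (i, j)"
      using ij by simp
  qed (auto simp: carrier)
  have "det D = (\<Prod>i<n. d i)"
    by (subst det_upper_triangular[of _ n])
      (auto simp: D_def prod_list_diag_prod lessThan_atLeast0)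
  also have "\<dots> = (x + 1) ^ k * x ^ (n - k)"
    unfolding split by (simp add: d_def card_compl S)
  finally have detD: "det D = (x + 1) ^ k * x ^ (n - k)" .
  \<comment> \<open>\<open>char_matrix ?A x\<close> is \<open>?A\<close> minus \<open>x\<close>
    times the identity, hence the sign.\<close>
  have "- char_matrix ?A x = D - U * V"
    by (intro eq_matI)
      (auto simp: carrier char_matrix_def scalar_prod_def d_def numeral_2_eq_2)
  hence "poly (char_poly ?A) x = det (D - U * V)"
    by (subst char_poly_matrix[of _ n]) auto
  also have "\<dots> = det D * det (1\<^sub>m 2 - V * D' * U)"
    using inv by (intro det_minus_mult_mat[of _ n]) (auto simp: carrier)
  also have "det (1\<^sub>m 2 - V * D' * U) = 1 - p - p * t"
    unfolding prodeq by (subst det_mat_2) auto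
  \<comment> \<open>One factor \<open>x + 1\<close> and one factor \<open>x\<close> are split off to
    cancel the denominators of \<open>p\<close> and \<open>t\<close>; both exist because
    \<open>1 <= k < n\<close>.\<close>
  also have "det D = (x + 1) ^ (k - 1) * x ^ (n - k - 1) * ((x + 1) * x)"
    using k unfolding detD by (cases k; cases "n - k") auto
  also have "\<dots> * (1 - p - p * t) =
      (x + 1) ^ (k - 1) * x ^ (n - k - 1) * ((x + 1) * x * (1 - p - p * t))"
    by (simp only: mult.assoc)
  also have "(x + 1) * x * (1 - p - p * t) =
      x\<^sup>2 - of_nat (k - 1) * x - of_nat k * of_nat (n - k)"
  proof -
    have "(x + 1) * x * (1 - p - p * t) = (x + 1) * x - x * ((x + 1) * p) - ((x + 1) * p) * (x * t)"
      by (simp add: algebra_simps)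
    also have "(x + 1) * p = of_nat k"
      using x by (simp add: p_def)
    also have "x * t = of_nat (n - k)"
      using x by (simp add: t_def)
    finally show ?thesis
      using k by (simp add: power2_eq_square of_nat_diff algebra_simps)
  qed
  finally show ?thesis .
qed

text \<open>Characteristic zero makes the field infinite, so discarding the points \<open>0\<close>
  and \<open>- 1\<close> still leaves too many roots for a nonzero difference.\<close>

lemma char_poly_split_graph:
  assumes "S \<subseteq> {..<n}" "card S = k" "1 \<le> k" "k < n"
  shows "char_poly (mat n n (\<lambda>(i, j). if i \<noteq> j \<and> (i \<in> S \<or> j \<in> S) then 1 else 0)) =
    [:1, 1 :: 'a :: field_char_0:] ^ (k - 1) * [:0, 1:] ^ (n - k - 1) *
    [:- (of_nat k * of_nat (n - k)), - of_nat (k - 1), 1:]" (is "?p = ?q")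
proof (rule ccontr)
  assume "?p \<noteq> ?q"
  hence "finite {x. poly (?p - ?q) x = 0}"
    by (intro poly_roots_finite) simp
  moreover have "poly (?p - ?q) x = 0" if "x \<notin> {0, - 1}" for x
    using that poly_char_poly_split_graph[OF assms, of x]
    by (simp add: algebra_simps power2_eq_square add_eq_0_iff)
  hence "- {0, - 1} \<subseteq> {x. poly (?p - ?q) x = 0}" by blast
  ultimately have "finite (- {0, - 1 :: 'a})" by (rule rev_finite_subset)
  thus False by (simp add: finite_compl infinite_UNIV_char_0)
qed

lemma proots_linear_power: "proots ([:- a, 1 :: 'a :: idom:] ^ m) = replicate_mset m a"
  by (simp add: proots_power)

text \<open>The tag \<open>Inl\<close> marks the clique vertices, and two distinct vertices of the
  join are non-adjacent only if both carry \<open>Inr\<close>.\<close>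

lemma adjacency_matrix_join_complete_empty:
  assumes "complete_digraph k (with_proj G)" and "empty_digraph m (with_proj H)"
    and "distinct vs" and "set vs = pverts (graph_join G H)"
  shows "adjacency_matrix (graph_join G H) vs =
    mat (length vs) (length vs)
      (\<lambda>(i, j). if i \<noteq> j \<and> (vs ! i \<in> range Inl \<or> vs ! j \<in> range Inl) then 1 else 0)"
proof -
  have G: "parcs G = {(u, v). (u, v) \<in> pverts G \<times> pverts G \<and> u \<noteq> v}"
    using assms(1) by (simp add: complete_digraph_pair_def)
  have H: "parcs H = {}"
    using assms(2) by (simp add: empty_digraph_def)
  have "(u, v) \<in> parcs (graph_join G H) \<longleftrightarrow> u \<noteq> v \<and> (u \<in> range Inl \<or> v \<in> range Inl)"
    if "u \<in> set vs" "v \<in> set vs" for u v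
    using that unfolding assms(4) graph_join_def G H by auto
  thus ?thesis
    using assms(3) by (auto simp: adjacency_matrix_def nth_eq_iff_index_eq intro!: eq_matI)
qed

theorem theorem3p4p1:
  fixes k n :: nat
    and G :: "'a pair_pre_digraph" and H :: "'b pair_pre_digraph"
    and vs :: "('a + 'b) list"
  assumes "1 \<le> k" and "k < n"
    and "complete_digraph k (with_proj G)"
    and "empty_digraph (n - k) (with_proj H)"
    and "distinct vs" and "set vs = pverts (graph_join G H)"
  shows "eigenvalue_mset (adjacency_matrix (graph_join G H) vs) =
    {# complex_of_real (((real k - 1) + sqrt ((real k - 1)\<^sup>2 + 4 * real k * (real n - real k))) / 2),
       complex_of_real (((real k - 1) - sqrt ((real k - 1)\<^sup>2 + 4 * real k * (real n - real k))) / 2) #}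
    + replicate_mset (k - 1) (- 1) + replicate_mset (n - k - 1) 0"
proof -
  \<comment> \<open>The enumeration is arbitrary, so the clique occupies some set \<open>S\<close>
    of positions, not necessarily an initial segment.\<close>
  define S where "S = {i. i < length vs \<and> vs ! i \<in> range Inl}"
  define r where "r = sqrt ((real k - 1)\<^sup>2 + 4 * real k * (real n - real k))"
  define a where "a = ((real k - 1) + r) / 2"
  define b where "b = ((real k - 1) - r) / 2"
  have G: "finite (pverts G)" "card (pverts G) = k"
    using assms(3) by (simp_all add: complete_digraph_pair_def)
  have "card (pverts H) = n - k"
    using assms(4) by (simp add: empty_digraph_def)
  \<comment> \<open>An infinite set would have \<open>card\<close> equal to \<open>0\<close>, but
    \<open>n - k\<close> is positive.\<close>
  moreover from this have "finite (pverts H)"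
    using assms(2) card.infinite by fastforce
  moreover have verts: "set vs = pverts G <+> pverts H"
    using assms(6) by (simp add: graph_join_def)
  ultimately have len: "length vs = n"
    using G assms(2) distinct_card[OF assms(5)] by (simp add: card_Plus)
  have "set vs = (!) vs ` {..<length vs}"
    by (auto simp: set_conv_nth)
  moreover have "(!) vs ` {i. i < length vs \<and> vs ! i \<in> B} = (!) vs ` {..<length vs} \<inter> B" for B
    by auto
  ultimately have "(!) vs ` S = set vs \<inter> range Inl"
    by (simp only: S_def)
  also have "\<dots> = Inl ` pverts G"
    unfolding verts by auto
  finally have "card ((!) vs ` S) = k"
    using G by (simp add: card_image)
  moreover have "inj_on ((!) vs) S"
    using assms(5) by (auto simp: S_def inj_on_def nth_eq_iff_index_eq)
  ultimately have card: "card S = k" by (simp add: card_image)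
  have "adjacency_matrix (graph_join G H) vs =
      mat n n (\<lambda>(i, j). if i \<noteq> j \<and> (i \<in> S \<or> j \<in> S) then 1 else (0 :: complex))"
    unfolding adjacency_matrix_join_complete_empty[OF assms(3-6)]
    by (auto simp: S_def len intro!: eq_matI)
  hence "char_poly (adjacency_matrix (graph_join G H) vs :: complex mat) =
      [:1, 1:] ^ (k - 1) * [:0, 1:] ^ (n - k - 1) *
      [:- (of_nat k * of_nat (n - k)), - of_nat (k - 1), 1:]"
    using char_poly_split_graph[of S n k] card assms(1,2) by (auto simp: S_def len)
  \<comment> \<open>Vieta: it suffices to compute the product and the sum of \<open>a\<close> and
    \<open>b\<close>, first over the reals.\<close>
  also have "[:- (of_nat k * of_nat (n - k)), - of_nat (k - 1), 1:] =
      [:- complex_of_real a, 1:] * [:- complex_of_real b, 1:]"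
  proof -
    \<comment> \<open>The radicand is nonnegative because \<open>k < n\<close>.\<close>
    have "r\<^sup>2 = (real k - 1)\<^sup>2 + 4 * real k * (real n - real k)"
      unfolding r_def using assms(2) by simp
    hence "a * b = - (real k * real (n - k))"
      using assms(2) by (simp add: a_def b_def field_simps power2_eq_square of_nat_diff)
    hence "complex_of_real a * complex_of_real b = - (of_nat k * of_nat (n - k))"
      by (metis of_real_minus of_real_mult of_real_of_nat_eq)
    moreover have "a + b = real (k - 1)"
      using assms(1) by (simp add: a_def b_def of_nat_diff field_simps)
    hence "complex_of_real a + complex_of_real b = of_nat (k - 1)"
      by (metis of_real_add of_real_of_nat_eq)
    ultimately show ?thesis by (simp add: algebra_simps)
  qed
  finally have "eigenvalue_mset (adjacency_matrix (graph_join G H) vs) =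
      proots ([:- (- 1), 1:] ^ (k - 1) * [:- 0, 1:] ^ (n - k - 1) *
        ([:- complex_of_real a, 1:] * [:- complex_of_real b, 1:]))"
    by (simp add: eigenvalue_mset_def)
  also have "\<dots> = {# complex_of_real a, complex_of_real b #}
      + replicate_mset (k - 1) (- 1) + replicate_mset (n - k - 1) 0"
    \<comment> \<open>Exponent \<open>1\<close> covers the factors for \<open>a\<close> and
      \<open>b\<close>. The \<open>pCons\<close> product rules are disabled so that the product
      stays factored for \<open>proots_mult\<close>.\<close>
    using proots_linear_power[of "complex_of_real a" 1] proots_linear_power[of "complex_of_real b" 1]
      proots_linear_power[of "- 1 :: complex" "k - 1"] proots_linear_power[of "0 :: complex" "n - k - 1"]
    by (simp add: proots_mult del: mult_pCons_left mult_pCons_right)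
  finally show ?thesis
    unfolding a_def b_def r_def .
qed

end
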